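(* Let $(\mathsf{T},\mu,\eta)$ be a monad on a category $\mathbb{X}$ with finite biproducts. Then $(\mathsf{T},\mu,\eta)$ is a Hopf monad if and only if it has a fusion invertor. Explicitly: (i) If $(\mathsf{T},\mu,\eta)$ is a Hopf monad, with fusion operator $\mathsf{h}$, then $(\mathsf{T},\mu,\eta)$ has a fusion invertor $\mathsf{h}^\circ_A:\mathsf{T}(A)\to\mathsf{T}(A\oplus\mathsf{T}(\mathsf{0}))$ defined by $\mathsf{h}^\circ_A := \mathsf{h}^{-1}_{A,\mathsf{0}}\circ\iota_1$, where $\iota_1:\mathsf{T}(A)\to\mathsf{T}(A)\oplus\mathsf{T}(\mathsf{0})$ is the first injection. (ii) If $(\mathsf{T},\mu,\eta)$ has a fusion invertor $\mathsf{h}^\circ$, then $(\mathsf{T},\mu,\eta)$ is a Hopf monad, where the inverse $\mathsf{h}^{-1}_{A,B}:\mathsf{T}(A)\oplus\mathsf{T}(B)\to\mathsf{T}(A\oplus\mathsf{T}(B))$ of the fusion operator is $$\mathsf{h}^{-1}_{A,B}=\mathsf{T}(1_A\oplus\mathsf{T}(0))\circ\mathsf{h}^\circ_A\circ\pi_1+\mathsf{T}(\iota_2)\circ\eta_{\mathsf{T}(B)}\circ\pi_2,$$ where $0:\mathsf{0}\to B$ is the zero map.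
   Context: In a category $\mathbb{X}$ with finite biproducts, $\oplus$ denotes the biproduct, with injections $\iota_j$ and projections $\pi_j$; $\mathsf{0}$ denotes the zero object; $f+g$ denotes the sum of parallel maps and $0$ the zero maps in the induced commutative monoid enrichment (negatives are not assumed). A monad is a triple $(\mathsf{T},\mu,\eta)$ with endofunctor $\mathsf{T}$ (not assumed additive, nor to preserve zero maps), multiplication $\mu_A:\mathsf{T}\mathsf{T}(A)\to\mathsf{T}(A)$ and unit $\eta_A:A\to\mathsf{T}(A)$. The fusion operator of a monad $(\mathsf{T},\mu,\eta)$ on $\mathbb{X}$ is the natural transformation $\mathsf{h}_{A,B}:\mathsf{T}(A\oplus\mathsf{T}(B))\to\mathsf{T}(A)\oplus\mathsf{T}(B)$ defined by $\mathsf{h}_{A,B}=\iota_1\circ\mathsf{T}(\pi_1)+\iota_2\circ\mu_B\circ\mathsf{T}(\pi_2)$. The monad is a Hopf monad if $\mathsf{h}$ is a natural isomorphism. A fusion invertor for $(\mathsf{T},\mu,\eta)$ is a natural transformation $\mathsf{h}^\circ_A:\mathsf{T}(A)\to\mathsf{T}(A\oplus\mathsf{T}(\mathsf{0}))$ such that for every object $A$: [FI.1] $\mathsf{T}(\pi_1)\circ\mathsf{h}^\circ_A=1_{\mathsf{T}(A)}$; [FI.2] $\mu_{\mathsf{0}}\circ\mathsf{T}(\pi_2)\circ\mathsf{h}^\circ_A=0$; [FI.3] for every object $B$, $\mathsf{T}(1_A\oplus\mathsf{T}(0))\circ\mathsf{h}^\circ_A\circ\mathsf{T}(\pi_1)+\mathsf{T}(\iota_2)\circ\eta_{\mathsf{T}(B)}\circ\mu_B\circ\mathsf{T}(\pi_2)=1_{\mathsf{T}(A\oplus\mathsf{T}(B))}$,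 where $0:\mathsf{0}\to B$ is the zero map. *)

theory Defs
  imports Main
begin

section \<open>Categories, functors and natural transformations\<close>

record ('o, 'a) category =
  Obj :: "'o set"
  Arr :: "'a set"
  Dom :: "'a \<Rightarrow> 'o"
  Cod :: "'a \<Rightarrow> 'o"
  Idn :: "'o \<Rightarrow> 'a"  ("\<one>\<index>")
  Cmp :: "'a \<Rightarrow> 'a \<Rightarrow> 'a"  (infixr "\<cdot>\<index>" 70)

definition hom :: "('o, 'a, 'm) category_scheme \<Rightarrow> 'o \<Rightarrow> 'o \<Rightarrow> 'a set" where
  "hom X A B = {f \<in> Arr X. Dom X f = A \<and> Cod X f = B}"

locale category =
  fixes X :: "('o, 'a, 'm) category_scheme" (structure)
  assumes dom_closed: "f \<in> Arr X \<Longrightarrow> Dom X f \<in> Obj X"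
    and cod_closed: "f \<in> Arr X \<Longrightarrow> Cod X f \<in> Obj X"
    and id_hom: "A \<in> Obj X \<Longrightarrow> \<one> A \<in> hom X A A"
    and comp_hom: "f \<in> hom X A B \<Longrightarrow> g \<in> hom X B C \<Longrightarrow> g \<cdot> f \<in> hom X A C"
    and comp_id_right: "f \<in> hom X A B \<Longrightarrow> f \<cdot> \<one> A = f"
    and comp_id_left: "f \<in> hom X A B \<Longrightarrow> \<one> B \<cdot> f = f"
    and comp_assoc: "f \<in> hom X A B \<Longrightarrow> g \<in> hom X B C \<Longrightarrow> h \<in> hom X C D
      \<Longrightarrow> (h \<cdot> g) \<cdot> f = h \<cdot> (g \<cdot> f)"

definition inverse_arrows :: "('o, 'a, 'm) category_scheme \<Rightarrow> 'a \<Rightarrow> 'a \<Rightarrow> bool" where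
  "inverse_arrows X f g \<longleftrightarrow> f \<in> Arr X \<and> g \<in> hom X (Cod X f) (Dom X f)
     \<and> g \<cdot>\<^bsub>X\<^esub> f = \<one>\<^bsub>X\<^esub> (Dom X f) \<and> f \<cdot>\<^bsub>X\<^esub> g = \<one>\<^bsub>X\<^esub> (Cod X f)"

definition isomorphism :: "('o, 'a, 'm) category_scheme \<Rightarrow> 'a \<Rightarrow> bool" where
  "isomorphism X f \<longleftrightarrow> (\<exists>g. inverse_arrows X f g)"

text \<open>Only meaningful when \<open>f\<close> is an isomorphism.\<close>
definition inverse_arrow :: "('o, 'a, 'm) category_scheme \<Rightarrow> 'a \<Rightarrow> 'a" where
  "inverse_arrow X f = (THE g. inverse_arrows X f g)"

definition prod_category ::
  "('o, 'a, 'm) category_scheme \<Rightarrow> ('p, 'b, 'n) category_scheme \<Rightarrow> ('o \<times> 'p, 'a \<times> 'b) category" where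
  "prod_category X Y =
    \<lparr> Obj = Obj X \<times> Obj Y,
      Arr = Arr X \<times> Arr Y,
      Dom = (\<lambda>(f, g). (Dom X f, Dom Y g)),
      Cod = (\<lambda>(f, g). (Cod X f, Cod Y g)),
      Idn = (\<lambda>(A, B). (\<one>\<^bsub>X\<^esub> A, \<one>\<^bsub>Y\<^esub> B)),
      Cmp = (\<lambda>(f', g') (f, g). (f' \<cdot>\<^bsub>X\<^esub> f, g' \<cdot>\<^bsub>Y\<^esub> g)) \<rparr>"

record ('o, 'a, 'p, 'b) functor_data =
  fob :: "'o \<Rightarrow> 'p"
  far :: "'a \<Rightarrow> 'b"

definition id_functor :: "('o, 'a, 'o, 'a) functor_data" where
  "id_functor = \<lparr> fob = (\<lambda>A. A), far = (\<lambda>f. f) \<rparr>"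

definition comp_functor ::
  "('p, 'b, 'q, 'c) functor_data \<Rightarrow> ('o, 'a, 'p, 'b) functor_data \<Rightarrow> ('o, 'a, 'q, 'c) functor_data" where
  "comp_functor G F = \<lparr> fob = (\<lambda>A. fob G (fob F A)), far = (\<lambda>f. far G (far F f)) \<rparr>"

locale cat_functor = C: category C + D: category D
  for C :: "('o, 'a, 'm) category_scheme"
    and D :: "('p, 'b, 'n) category_scheme" +
  fixes F :: "('o, 'a, 'p, 'b) functor_data"
  assumes fob_closed: "A \<in> Obj C \<Longrightarrow> fob F A \<in> Obj D"
    and far_hom: "f \<in> hom C A B \<Longrightarrow> far F f \<in> hom D (fob F A) (fob F B)"
    and far_id: "A \<in> Obj C \<Longrightarrow> far F (\<one>\<^bsub>C\<^esub> A) = \<one>\<^bsub>D\<^esub> (fob F A)"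
    and far_comp: "f \<in> hom C A B \<Longrightarrow> g \<in> hom C B E
      \<Longrightarrow> far F (g \<cdot>\<^bsub>C\<^esub> f) = far F g \<cdot>\<^bsub>D\<^esub> far F f"

locale natural_transformation = F: cat_functor C D F + G: cat_functor C D G
  for C :: "('o, 'a, 'm) category_scheme"
    and D :: "('p, 'b, 'n) category_scheme"
    and F :: "('o, 'a, 'p, 'b) functor_data"
    and G :: "('o, 'a, 'p, 'b) functor_data" +
  fixes \<tau> :: "'o \<Rightarrow> 'b"
  assumes component_hom: "A \<in> Obj C \<Longrightarrow> \<tau> A \<in> hom D (fob F A) (fob G A)"
    and naturality: "f \<in> hom C A B \<Longrightarrow> \<tau> B \<cdot>\<^bsub>D\<^esub> far F f = far G f \<cdot>\<^bsub>D\<^esub> \<tau> A"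

locale natural_isomorphism = natural_transformation C D F G \<tau>
  for C :: "('o, 'a, 'm) category_scheme"
    and D :: "('p, 'b, 'n) category_scheme"
    and F :: "('o, 'a, 'p, 'b) functor_data"
    and G :: "('o, 'a, 'p, 'b) functor_data"
    and \<tau> :: "'o \<Rightarrow> 'b" +
  assumes component_iso: "A \<in> Obj C \<Longrightarrow> isomorphism D (\<tau> A)"


section \<open>Finite biproducts and the induced sum of parallel maps\<close>

record ('o, 'a) biproduct_category = "('o, 'a) category" +
  Zero :: 'o  ("\<zero>\<index>")
  Oplus :: "'o \<Rightarrow> 'o \<Rightarrow> 'o"  (infixl "\<oplus>\<index>" 75)
  Inj1 :: "'o \<Rightarrow> 'o \<Rightarrow> 'a"  ("\<iota>\<^sub>1\<index>")
  Inj2 :: "'o \<Rightarrow> 'o \<Rightarrow> 'a"  ("\<iota>\<^sub>2\<index>")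
  Prj1 :: "'o \<Rightarrow> 'o \<Rightarrow> 'a"  ("\<pi>\<^sub>1\<index>")
  Prj2 :: "'o \<Rightarrow> 'o \<Rightarrow> 'a"  ("\<pi>\<^sub>2\<index>")

definition zero_map :: "('o, 'a, 'm) biproduct_category_scheme \<Rightarrow> 'o \<Rightarrow> 'o \<Rightarrow> 'a" where
  "zero_map X A B = (THE f. f \<in> hom X \<zero>\<^bsub>X\<^esub> B) \<cdot>\<^bsub>X\<^esub> (THE f. f \<in> hom X A \<zero>\<^bsub>X\<^esub>)"

text \<open>Finite biproducts are given by a chosen zero object and chosen binary biproducts.
  No addition of maps is part of the data: it is derived below.\<close>
locale biproduct_category = category X
  for X :: "('o, 'a, 'm) biproduct_category_scheme" (structure) +
  assumes zero_closed: "\<zero> \<in> Obj X"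
    and zero_initial: "A \<in> Obj X \<Longrightarrow> \<exists>!f. f \<in> hom X \<zero> A"
    and zero_terminal: "A \<in> Obj X \<Longrightarrow> \<exists>!f. f \<in> hom X A \<zero>"
    and oplus_closed: "A \<in> Obj X \<Longrightarrow> B \<in> Obj X \<Longrightarrow> A \<oplus> B \<in> Obj X"
    and inj1_hom: "A \<in> Obj X \<Longrightarrow> B \<in> Obj X \<Longrightarrow> \<iota>\<^sub>1 A B \<in> hom X A (A \<oplus> B)"
    and inj2_hom: "A \<in> Obj X \<Longrightarrow> B \<in> Obj X \<Longrightarrow> \<iota>\<^sub>2 A B \<in> hom X B (A \<oplus> B)"
    and prj1_hom: "A \<in> Obj X \<Longrightarrow> B \<in> Obj X \<Longrightarrow> \<pi>\<^sub>1 A B \<in> hom X (A \<oplus> B) A"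
    and prj2_hom: "A \<in> Obj X \<Longrightarrow> B \<in> Obj X \<Longrightarrow> \<pi>\<^sub>2 A B \<in> hom X (A \<oplus> B) B"
    and product_universal: "f \<in> hom X C A \<Longrightarrow> g \<in> hom X C B
      \<Longrightarrow> \<exists>!h. h \<in> hom X C (A \<oplus> B) \<and> \<pi>\<^sub>1 A B \<cdot> h = f \<and> \<pi>\<^sub>2 A B \<cdot> h = g"
    and coproduct_universal: "f \<in> hom X A C \<Longrightarrow> g \<in> hom X B C
      \<Longrightarrow> \<exists>!h. h \<in> hom X (A \<oplus> B) C \<and> h \<cdot> \<iota>\<^sub>1 A B = f \<and> h \<cdot> \<iota>\<^sub>2 A B = g"
    and prj1_inj1: "A \<in> Obj X \<Longrightarrow> B \<in> Obj X \<Longrightarrow> \<pi>\<^sub>1 A B \<cdot> \<iota>\<^sub>1 A B = \<one> A"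
    and prj2_inj2: "A \<in> Obj X \<Longrightarrow> B \<in> Obj X \<Longrightarrow> \<pi>\<^sub>2 A B \<cdot> \<iota>\<^sub>2 A B = \<one> B"
    and prj1_inj2: "A \<in> Obj X \<Longrightarrow> B \<in> Obj X \<Longrightarrow> \<pi>\<^sub>1 A B \<cdot> \<iota>\<^sub>2 A B = zero_map X B A"
    and prj2_inj1: "A \<in> Obj X \<Longrightarrow> B \<in> Obj X \<Longrightarrow> \<pi>\<^sub>2 A B \<cdot> \<iota>\<^sub>1 A B = zero_map X A B"

definition pairing :: "('o, 'a, 'm) biproduct_category_scheme \<Rightarrow> 'a \<Rightarrow> 'a \<Rightarrow> 'a" where
  "pairing X f g = (THE h. h \<in> hom X (Dom X f) (Cod X f \<oplus>\<^bsub>X\<^esub> Cod X g)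
     \<and> \<pi>\<^sub>1\<^bsub>X\<^esub> (Cod X f) (Cod X g) \<cdot>\<^bsub>X\<^esub> h = f \<and> \<pi>\<^sub>2\<^bsub>X\<^esub> (Cod X f) (Cod X g) \<cdot>\<^bsub>X\<^esub> h = g)"

definition copairing :: "('o, 'a, 'm) biproduct_category_scheme \<Rightarrow> 'a \<Rightarrow> 'a \<Rightarrow> 'a" where
  "copairing X f g = (THE h. h \<in> hom X (Dom X f \<oplus>\<^bsub>X\<^esub> Dom X g) (Cod X f)
     \<and> h \<cdot>\<^bsub>X\<^esub> \<iota>\<^sub>1\<^bsub>X\<^esub> (Dom X f) (Dom X g) = f \<and> h \<cdot>\<^bsub>X\<^esub> \<iota>\<^sub>2\<^bsub>X\<^esub> (Dom X f) (Dom X g) = g)"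

text \<open>The biproduct of two maps; \<open>\<oplus>\<close> itself is reserved for objects.\<close>
definition oplus_map :: "('o, 'a, 'm) biproduct_category_scheme \<Rightarrow> 'a \<Rightarrow> 'a \<Rightarrow> 'a"
    (infixl "\<boxplus>\<index>" 75) where
  "f \<boxplus>\<^bsub>X\<^esub> g = pairing X
     (f \<cdot>\<^bsub>X\<^esub> \<pi>\<^sub>1\<^bsub>X\<^esub> (Dom X f) (Dom X g)) (g \<cdot>\<^bsub>X\<^esub> \<pi>\<^sub>2\<^bsub>X\<^esub> (Dom X f) (Dom X g))"

text \<open>The sum of parallel maps \<open>f, g : A \<rightarrow> B\<close> in the induced enrichment: the diagonal of \<open>A\<close>,
  followed by the biproduct of \<open>f\<close> and \<open>g\<close>, followed by the codiagonal of \<open>B\<close>.\<close>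
definition sum_map :: "('o, 'a, 'm) biproduct_category_scheme \<Rightarrow> 'a \<Rightarrow> 'a \<Rightarrow> 'a"
    (infixl "\<^bold>+\<index>" 65) where
  "f \<^bold>+\<^bsub>X\<^esub> g = copairing X (\<one>\<^bsub>X\<^esub> (Cod X f)) (\<one>\<^bsub>X\<^esub> (Cod X f))
     \<cdot>\<^bsub>X\<^esub> (f \<boxplus>\<^bsub>X\<^esub> g) \<cdot>\<^bsub>X\<^esub> pairing X (\<one>\<^bsub>X\<^esub> (Dom X f)) (\<one>\<^bsub>X\<^esub> (Dom X f))"


section \<open>Monads, fusion operators and fusion invertors\<close>

locale monad = T: cat_functor X X T
    + mult: natural_transformation X X "comp_functor T T" T \<mu>
    + unit: natural_transformation X X id_functor T \<eta>
  for X :: "('o, 'a, 'm) category_scheme"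
    and T :: "('o, 'a, 'o, 'a) functor_data"
    and \<mu> :: "'o \<Rightarrow> 'a"
    and \<eta> :: "'o \<Rightarrow> 'a" +
  assumes mult_assoc: "A \<in> Obj X \<Longrightarrow> \<mu> A \<cdot>\<^bsub>X\<^esub> \<mu> (fob T A) = \<mu> A \<cdot>\<^bsub>X\<^esub> far T (\<mu> A)"
    and unit_left: "A \<in> Obj X \<Longrightarrow> \<mu> A \<cdot>\<^bsub>X\<^esub> \<eta> (fob T A) = \<one>\<^bsub>X\<^esub> (fob T A)"
    and unit_right: "A \<in> Obj X \<Longrightarrow> \<mu> A \<cdot>\<^bsub>X\<^esub> far T (\<eta> A) = \<one>\<^bsub>X\<^esub> (fob T A)"

definition fusion_operator ::
  "('o, 'a, 'm) biproduct_category_scheme \<Rightarrow> ('o, 'a, 'o, 'a) functor_data \<Rightarrow> ('o \<Rightarrow> 'a)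
    \<Rightarrow> 'o \<Rightarrow> 'o \<Rightarrow> 'a" where
  "fusion_operator X T \<mu> A B =
     \<iota>\<^sub>1\<^bsub>X\<^esub> (fob T A) (fob T B) \<cdot>\<^bsub>X\<^esub> far T (\<pi>\<^sub>1\<^bsub>X\<^esub> A (fob T B))
     \<^bold>+\<^bsub>X\<^esub> \<iota>\<^sub>2\<^bsub>X\<^esub> (fob T A) (fob T B) \<cdot>\<^bsub>X\<^esub> \<mu> B \<cdot>\<^bsub>X\<^esub> far T (\<pi>\<^sub>2\<^bsub>X\<^esub> A (fob T B))"

definition fusion_source ::
  "('o, 'a, 'm) biproduct_category_scheme \<Rightarrow> ('o, 'a, 'o, 'a) functor_data
    \<Rightarrow> ('o \<times> 'o, 'a \<times> 'a, 'o, 'a) functor_data" where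
  "fusion_source X T =
    \<lparr> fob = (\<lambda>(A, B). fob T (A \<oplus>\<^bsub>X\<^esub> fob T B)),
      far = (\<lambda>(f, g). far T (f \<boxplus>\<^bsub>X\<^esub> far T g)) \<rparr>"

definition fusion_target ::
  "('o, 'a, 'm) biproduct_category_scheme \<Rightarrow> ('o, 'a, 'o, 'a) functor_data
    \<Rightarrow> ('o \<times> 'o, 'a \<times> 'a, 'o, 'a) functor_data" where
  "fusion_target X T =
    \<lparr> fob = (\<lambda>(A, B). fob T A \<oplus>\<^bsub>X\<^esub> fob T B),
      far = (\<lambda>(f, g). far T f \<boxplus>\<^bsub>X\<^esub> far T g) \<rparr>"

definition hopf_monad ::
  "('o, 'a, 'm) biproduct_category_scheme \<Rightarrow> ('o, 'a, 'o, 'a) functor_data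
    \<Rightarrow> ('o \<Rightarrow> 'a) \<Rightarrow> ('o \<Rightarrow> 'a) \<Rightarrow> bool" where
  "hopf_monad X T \<mu> \<eta> \<longleftrightarrow> monad X T \<mu> \<eta> \<and>
     natural_isomorphism (prod_category X X) X (fusion_source X T) (fusion_target X T)
       (\<lambda>(A, B). fusion_operator X T \<mu> A B)"

definition invertor_target ::
  "('o, 'a, 'm) biproduct_category_scheme \<Rightarrow> ('o, 'a, 'o, 'a) functor_data
    \<Rightarrow> ('o, 'a, 'o, 'a) functor_data" where
  "invertor_target X T =
    \<lparr> fob = (\<lambda>A. fob T (A \<oplus>\<^bsub>X\<^esub> fob T \<zero>\<^bsub>X\<^esub>)),
      far = (\<lambda>f. far T (f \<boxplus>\<^bsub>X\<^esub> \<one>\<^bsub>X\<^esub> (fob T \<zero>\<^bsub>X\<^esub>))) \<rparr>"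

locale fusion_invertor = monad X T \<mu> \<eta> + natural_transformation X X T "invertor_target X T" k
  for X :: "('o, 'a, 'm) biproduct_category_scheme"
    and T :: "('o, 'a, 'o, 'a) functor_data"
    and \<mu> :: "'o \<Rightarrow> 'a"
    and \<eta> :: "'o \<Rightarrow> 'a"
    and k :: "'o \<Rightarrow> 'a" +
  assumes FI1: "A \<in> Obj X
      \<Longrightarrow> far T (\<pi>\<^sub>1\<^bsub>X\<^esub> A (fob T \<zero>\<^bsub>X\<^esub>)) \<cdot>\<^bsub>X\<^esub> k A = \<one>\<^bsub>X\<^esub> (fob T A)"
    and FI2: "A \<in> Obj X
      \<Longrightarrow> \<mu> \<zero>\<^bsub>X\<^esub> \<cdot>\<^bsub>X\<^esub> far T (\<pi>\<^sub>2\<^bsub>X\<^esub> A (fob T \<zero>\<^bsub>X\<^esub>)) \<cdot>\<^bsub>X\<^esub> k A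
            = zero_map X (fob T A) (fob T \<zero>\<^bsub>X\<^esub>)"
    and FI3: "A \<in> Obj X \<Longrightarrow> B \<in> Obj X
      \<Longrightarrow> far T (\<one>\<^bsub>X\<^esub> A \<boxplus>\<^bsub>X\<^esub> far T (zero_map X \<zero>\<^bsub>X\<^esub> B)) \<cdot>\<^bsub>X\<^esub> k A \<cdot>\<^bsub>X\<^esub> far T (\<pi>\<^sub>1\<^bsub>X\<^esub> A (fob T B))
          \<^bold>+\<^bsub>X\<^esub> far T (\<iota>\<^sub>2\<^bsub>X\<^esub> A (fob T B)) \<cdot>\<^bsub>X\<^esub> \<eta> (fob T B) \<cdot>\<^bsub>X\<^esub> \<mu> B \<cdot>\<^bsub>X\<^esub> far T (\<pi>\<^sub>2\<^bsub>X\<^esub> A (fob T B))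
          = \<one>\<^bsub>X\<^esub> (fob T (A \<oplus>\<^bsub>X\<^esub> fob T B))"

end

theory Submission
  imports Defs
begin

text \<open>The sum of parallel maps is the codiagonal after their pairing, so it is bilinear with unit
  the zero map, and the fusion operator \<open>h\<close> becomes the pairing of \<open>T \<pi>\<^sub>1\<close> and \<open>\<mu> \<cdot> T \<pi>\<^sub>2\<close>.
  Given an invertor, the candidate inverse precomposed with \<open>h\<close> is the left side of FI3; in the
  other order the two projections reduce to FI1 and FI2 by naturality of \<open>\<eta>\<close> and \<open>\<mu>\<close> at zero maps.
  Conversely, FI1 and FI2 read off the components of \<open>h \<cdot> h\<inverse> \<cdot> \<iota>\<^sub>1\<close>, while both sides of FI3
  agree after composing with the isomorphism \<open>h\<close>.\<close>

section \<open>Composition of arrows\<close>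

context category
begin

lemma homD:
  assumes "f \<in> hom X A B"
  shows "f \<in> Arr X" "Dom X f = A" "Cod X f = B"
  using assms by (auto simp: hom_def)

lemma dom_obj [simp]: "f \<in> Arr X \<Longrightarrow> Dom X f \<in> Obj X"
  by (rule dom_closed)

lemma cod_obj [simp]: "f \<in> Arr X \<Longrightarrow> Cod X f \<in> Obj X"
  by (rule cod_closed)

lemma idn_arr [simp]:
  assumes "A \<in> Obj X"
  shows "\<one> A \<in> Arr X" "Dom X (\<one> A) = A" "Cod X (\<one> A) = A"
  using homD[OF id_hom[OF assms]] by auto

lemma cmp_arr [simp]:
  assumes "f \<in> Arr X" "g \<in> Arr X" "Dom X g = Cod X f"
  shows "g \<cdot> f \<in> Arr X" "Dom X (g \<cdot> f) = Dom X f" "Cod X (g \<cdot> f) = Cod X g"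
  using homD[OF comp_hom[of f "Dom X f" "Cod X f" g "Cod X g"]] assms
  by (auto simp: hom_def)

lemma cmp_idn_right [simp]: "f \<in> Arr X \<Longrightarrow> Dom X f = A \<Longrightarrow> f \<cdot> \<one> A = f"
  using comp_id_right[of f A "Cod X f"] by (simp add: hom_def)

lemma cmp_idn_left [simp]: "f \<in> Arr X \<Longrightarrow> Cod X f = A \<Longrightarrow> \<one> A \<cdot> f = f"
  using comp_id_left[of f "Dom X f" A] by (simp add: hom_def)

lemma cmp_assoc [simp]:
  assumes "f \<in> Arr X" "g \<in> Arr X" "h \<in> Arr X" "Dom X g = Cod X f" "Dom X h = Cod X g"
  shows "(h \<cdot> g) \<cdot> f = h \<cdot> (g \<cdot> f)"
  by (rule comp_assoc[of f "Dom X f" "Cod X f" g "Cod X g" h "Cod X h"])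
    (use assms in \<open>auto simp: hom_def\<close>)

text \<open>The simp rule \<open>cmp_assoc\<close> nests composites to the right, where an equation
  for \<open>g \<cdot> f\<close> no longer matches once a further arrow precedes \<open>f\<close>.
  This form applies such an equation at the head of a longer composite.\<close>

lemma cmp_reassoc:
  assumes "g \<cdot> f = h" "f \<in> Arr X" "g \<in> Arr X" "Dom X g = Cod X f"
    and "x \<in> Arr X" "Cod X x = Dom X f"
  shows "g \<cdot> (f \<cdot> x) = h \<cdot> x"
  using assms cmp_assoc[of x f g] by simp

section \<open>Uniqueness of inverses and cancellation of isomorphisms\<close>

lemma inverse_arrows_unique:
  assumes "inverse_arrows X f g" "inverse_arrows X f g'"
  shows "g = g'"
proof -
  have f: "f \<in> Arr X" and g: "g \<in> Arr X" "Dom X g = Cod X f" "Cod X g = Dom X f" "g \<cdot> f = \<one> (Dom X f)"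
    and g': "g' \<in> Arr X" "Dom X g' = Cod X f" "Cod X g' = Dom X f" "f \<cdot> g' = \<one> (Cod X f)"
    using assms by (auto simp: inverse_arrows_def hom_def)
  have "g = g \<cdot> (f \<cdot> g')" using f g g' by simp
  also have "\<dots> = (g \<cdot> f) \<cdot> g'" using f g g' by (subst cmp_assoc) auto
  also have "\<dots> = g'" using f g g' by simp
  finally show ?thesis .
qed

text \<open>Uniqueness lets the definite description in \<open>inverse_arrow\<close> evaluate to any
  inverse already at hand.\<close>

lemma inverse_arrow_eq:
  assumes "inverse_arrows X f g"
  shows "inverse_arrow X f = g"
  unfolding inverse_arrow_def
  using assms inverse_arrows_unique[OF _ assms] by (rule the_equality)

lemma inverse_arrow_inverse:
  assumes "isomorphism X f"
  shows "inverse_arrows X f (inverse_arrow X f)"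
  using assms inverse_arrow_eq by (auto simp: isomorphism_def)

text \<open>Equations between arrows into the source of the fusion operator, namely naturality of
  the invertor and FI3, are checked through this after composing with that operator.\<close>

lemma iso_cancel_left:
  assumes "isomorphism X f" "a \<in> Arr X" "b \<in> Arr X" "Cod X a = Dom X f" "Cod X b = Dom X f"
    and "f \<cdot> a = f \<cdot> b"
  shows "a = b"
proof -
  obtain g where g: "f \<in> Arr X" "g \<in> Arr X" "Dom X g = Cod X f" "g \<cdot> f = \<one> (Dom X f)"
    using assms(1) by (auto simp: isomorphism_def inverse_arrows_def hom_def)
  have "g \<cdot> (f \<cdot> a) = a" "g \<cdot> (f \<cdot> b) = b"
    using cmp_reassoc[OF g(4,1,2,3)] assms(2-5) by simp_all
  then show ?thesis using assms(6) by metis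
qed

end

section \<open>Functors on composable arrows\<close>

context cat_functor
begin

lemma far_arr [simp]:
  assumes "f \<in> Arr C"
  shows "far F f \<in> Arr D" "Dom D (far F f) = fob F (Dom C f)" "Cod D (far F f) = fob F (Cod C f)"
  using far_hom[of f "Dom C f" "Cod C f"] assms by (auto simp: hom_def)

lemma far_cmp:
  assumes "f \<in> Arr C" "g \<in> Arr C" "Dom C g = Cod C f"
  shows "far F g \<cdot>\<^bsub>D\<^esub> far F f = far F (g \<cdot>\<^bsub>C\<^esub> f)"
  using far_comp[of f "Dom C f" "Cod C f" g "Cod C g"] assms by (auto simp: hom_def)

lemma far_cmp_assoc:
  assumes "f \<in> Arr C" "g \<in> Arr C" "Dom C g = Cod C f" "x \<in> Arr D" "Cod D x = fob F (Dom C f)"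
  shows "far F g \<cdot>\<^bsub>D\<^esub> (far F f \<cdot>\<^bsub>D\<^esub> x) = far F (g \<cdot>\<^bsub>C\<^esub> f) \<cdot>\<^bsub>D\<^esub> x"
  by (rule D.cmp_reassoc) (use assms far_cmp in auto)

end

section \<open>The calculus of biproducts\<close>

context biproduct_category
begin

declare zero_closed [simp] oplus_closed [simp]

lemma inj_prj_arr [simp]:
  assumes "A \<in> Obj X" "B \<in> Obj X"
  shows "\<iota>\<^sub>1 A B \<in> Arr X" "Dom X (\<iota>\<^sub>1 A B) = A" "Cod X (\<iota>\<^sub>1 A B) = A \<oplus> B"
    "\<iota>\<^sub>2 A B \<in> Arr X" "Dom X (\<iota>\<^sub>2 A B) = B" "Cod X (\<iota>\<^sub>2 A B) = A \<oplus> B"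
    "\<pi>\<^sub>1 A B \<in> Arr X" "Dom X (\<pi>\<^sub>1 A B) = A \<oplus> B" "Cod X (\<pi>\<^sub>1 A B) = A"
    "\<pi>\<^sub>2 A B \<in> Arr X" "Dom X (\<pi>\<^sub>2 A B) = A \<oplus> B" "Cod X (\<pi>\<^sub>2 A B) = B"
  using assms inj1_hom inj2_hom prj1_hom prj2_hom by (auto simp: hom_def)

section \<open>Zero maps\<close>

lemma zero_map_factor:
  assumes "f \<in> hom X A \<zero>" "g \<in> hom X \<zero> B"
  shows "g \<cdot> f = zero_map X A B"
proof -
  have "A \<in> Obj X" "B \<in> Obj X" using assms dom_closed cod_closed by (auto simp: hom_def)
  then have "(THE f. f \<in> hom X A \<zero>) = f" "(THE g. g \<in> hom X \<zero> B) = g"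
    using assms by (auto intro!: the1_equality zero_terminal zero_initial)
  then show ?thesis by (simp add: zero_map_def)
qed

lemma zero_map_arr [simp]:
  assumes "A \<in> Obj X" "B \<in> Obj X"
  shows "zero_map X A B \<in> Arr X" "Dom X (zero_map X A B) = A" "Cod X (zero_map X A B) = B"
proof -
  obtain f g where "f \<in> hom X A \<zero>" "g \<in> hom X \<zero> B"
    using zero_terminal zero_initial assms by meson
  with zero_map_factor have "zero_map X A B \<in> hom X A B" using comp_hom by metis
  then show "zero_map X A B \<in> Arr X" "Dom X (zero_map X A B) = A" "Cod X (zero_map X A B) = B"
    by (auto simp: hom_def)
qed

text \<open>Composing a map that factors through \<open>\<zero>\<close> with \<open>k\<close> leaves
  a map that factors through \<open>\<zero>\<close>, and by \<open>zero_map_factor\<close> there is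
  only one such map between given objects.\<close>

lemma cmp_zero_map [simp]:
  assumes "A \<in> Obj X" "k \<in> Arr X" "Dom X k = B"
  shows "k \<cdot> zero_map X A B = zero_map X A (Cod X k)"
proof -
  have "B \<in> Obj X" using assms by auto
  then obtain f g where f: "f \<in> hom X A \<zero>" and g: "g \<in> hom X \<zero> B"
    using zero_terminal zero_initial assms by meson
  have k: "k \<in> hom X B (Cod X k)" using assms by (simp add: hom_def)
  show ?thesis
    using zero_map_factor[OF f g] zero_map_factor[OF f comp_hom[OF g k]] comp_assoc[OF f g k] by simp
qed

lemma zero_map_cmp [simp]:
  assumes "C \<in> Obj X" "k \<in> Arr X" "Cod X k = B"
  shows "zero_map X B C \<cdot> k = zero_map X (Dom X k) C"
proof -
  have "B \<in> Obj X" using assms by auto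
  then obtain f g where f: "f \<in> hom X B \<zero>" and g: "g \<in> hom X \<zero> C"
    using zero_terminal zero_initial assms by meson
  have k: "k \<in> hom X (Dom X k) B" using assms by (simp add: hom_def)
  show ?thesis
    using zero_map_factor[OF f g] zero_map_factor[OF comp_hom[OF k f] g] comp_assoc[OF k f g] by simp
qed

declare prj1_inj1 [simp] prj2_inj2 [simp] prj1_inj2 [simp] prj2_inj1 [simp]

lemma prj_inj_assoc [simp]:
  assumes "A \<in> Obj X" "B \<in> Obj X" "f \<in> Arr X"
  shows "Cod X f = A \<Longrightarrow> \<pi>\<^sub>1 A B \<cdot> (\<iota>\<^sub>1 A B \<cdot> f) = f"
    "Cod X f = B \<Longrightarrow> \<pi>\<^sub>2 A B \<cdot> (\<iota>\<^sub>2 A B \<cdot> f) = f"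
    "Cod X f = B \<Longrightarrow> \<pi>\<^sub>1 A B \<cdot> (\<iota>\<^sub>2 A B \<cdot> f) = zero_map X (Dom X f) A"
    "Cod X f = A \<Longrightarrow> \<pi>\<^sub>2 A B \<cdot> (\<iota>\<^sub>1 A B \<cdot> f) = zero_map X (Dom X f) B"
  using assms cmp_reassoc[OF prj1_inj1] cmp_reassoc[OF prj2_inj2]
    cmp_reassoc[OF prj1_inj2] cmp_reassoc[OF prj2_inj1] by simp_all

section \<open>Universal properties: extensionality, pairing and copairing\<close>

lemma product_eqI:
  assumes "h \<in> Arr X" "h' \<in> Arr X" "Cod X h = A \<oplus> B" "Cod X h' = A \<oplus> B" "Dom X h = Dom X h'"
    and "A \<in> Obj X" "B \<in> Obj X"
    and "\<pi>\<^sub>1 A B \<cdot> h = \<pi>\<^sub>1 A B \<cdot> h'" "\<pi>\<^sub>2 A B \<cdot> h = \<pi>\<^sub>2 A B \<cdot> h'"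
  shows "h = h'"
proof -
  have "\<pi>\<^sub>1 A B \<cdot> h' \<in> hom X (Dom X h') A" "\<pi>\<^sub>2 A B \<cdot> h' \<in> hom X (Dom X h') B"
    using assms by (simp_all add: hom_def)
  from product_universal[OF this] show ?thesis
    using assms by (auto simp: hom_def)
qed

lemma coproduct_eqI:
  assumes "h \<in> Arr X" "h' \<in> Arr X" "Dom X h = A \<oplus> B" "Dom X h' = A \<oplus> B" "Cod X h = Cod X h'"
    and "A \<in> Obj X" "B \<in> Obj X"
    and "h \<cdot> \<iota>\<^sub>1 A B = h' \<cdot> \<iota>\<^sub>1 A B" "h \<cdot> \<iota>\<^sub>2 A B = h' \<cdot> \<iota>\<^sub>2 A B"
  shows "h = h'"
proof -
  have "h' \<cdot> \<iota>\<^sub>1 A B \<in> hom X A (Cod X h')" "h' \<cdot> \<iota>\<^sub>2 A B \<in> hom X B (Cod X h')"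
    using assms by (simp_all add: hom_def)
  from coproduct_universal[OF this] show ?thesis
    using assms by (auto simp: hom_def)
qed

text \<open>The projection laws take \<open>A\<close> and \<open>B\<close> as variables with
  equational premises, so that they also match when the codomains agree with the indices only after
  simplification.\<close>

lemma pairing [simp]:
  assumes "f \<in> Arr X" "g \<in> Arr X" "Dom X f = Dom X g"
  shows "pairing X f g \<in> Arr X" "Dom X (pairing X f g) = Dom X g"
    "Cod X (pairing X f g) = Cod X f \<oplus> Cod X g"
    "A = Cod X f \<Longrightarrow> B = Cod X g \<Longrightarrow> \<pi>\<^sub>1 A B \<cdot> pairing X f g = f"
    "A = Cod X f \<Longrightarrow> B = Cod X g \<Longrightarrow> \<pi>\<^sub>2 A B \<cdot> pairing X f g = g"
proof -
  have "f \<in> hom X (Dom X f) (Cod X f)" "g \<in> hom X (Dom X f) (Cod X g)"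
    using assms by (simp_all add: hom_def)
  from theI'[OF product_universal[OF this], folded pairing_def]
  show "pairing X f g \<in> Arr X" "Dom X (pairing X f g) = Dom X g"
    "Cod X (pairing X f g) = Cod X f \<oplus> Cod X g"
    "A = Cod X f \<Longrightarrow> B = Cod X g \<Longrightarrow> \<pi>\<^sub>1 A B \<cdot> pairing X f g = f"
    "A = Cod X f \<Longrightarrow> B = Cod X g \<Longrightarrow> \<pi>\<^sub>2 A B \<cdot> pairing X f g = g"
    using assms by (auto simp: hom_def)
qed

lemma copairing [simp]:
  assumes "f \<in> Arr X" "g \<in> Arr X" "Cod X f = Cod X g"
  shows "copairing X f g \<in> Arr X" "Cod X (copairing X f g) = Cod X g"
    "Dom X (copairing X f g) = Dom X f \<oplus> Dom X g"
    "A = Dom X f \<Longrightarrow> B = Dom X g \<Longrightarrow> copairing X f g \<cdot> \<iota>\<^sub>1 A B = f"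
    "A = Dom X f \<Longrightarrow> B = Dom X g \<Longrightarrow> copairing X f g \<cdot> \<iota>\<^sub>2 A B = g"
proof -
  have "f \<in> hom X (Dom X f) (Cod X f)" "g \<in> hom X (Dom X g) (Cod X f)"
    using assms by (simp_all add: hom_def)
  from theI'[OF coproduct_universal[OF this], folded copairing_def]
  show "copairing X f g \<in> Arr X" "Cod X (copairing X f g) = Cod X g"
    "Dom X (copairing X f g) = Dom X f \<oplus> Dom X g"
    "A = Dom X f \<Longrightarrow> B = Dom X g \<Longrightarrow> copairing X f g \<cdot> \<iota>\<^sub>1 A B = f"
    "A = Dom X f \<Longrightarrow> B = Dom X g \<Longrightarrow> copairing X f g \<cdot> \<iota>\<^sub>2 A B = g"
    using assms by (auto simp: hom_def)
qed

lemma prj_pairing_assoc [simp]: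
  assumes "f \<in> Arr X" "g \<in> Arr X" "Dom X f = Dom X g" "x \<in> Arr X" "Cod X x = Dom X g"
    and "A = Cod X f" "B = Cod X g"
  shows "\<pi>\<^sub>1 A B \<cdot> (pairing X f g \<cdot> x) = f \<cdot> x" "\<pi>\<^sub>2 A B \<cdot> (pairing X f g \<cdot> x) = g \<cdot> x"
  using assms by (simp_all add: cmp_reassoc[of _ _ f] cmp_reassoc[of _ _ g])

lemma pairing_cmp:
  assumes "f \<in> Arr X" "g \<in> Arr X" "Dom X f = Dom X g" "x \<in> Arr X" "Cod X x = Dom X g"
  shows "pairing X f g \<cdot> x = pairing X (f \<cdot> x) (g \<cdot> x)"
  by (rule product_eqI[of _ _ "Cod X f" "Cod X g"]) (use assms in simp_all)

section \<open>The biproduct of maps as a bifunctor\<close>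

lemma oplus_map [simp]:
  assumes "f \<in> Arr X" "g \<in> Arr X"
  shows "f \<boxplus> g \<in> Arr X" "Dom X (f \<boxplus> g) = Dom X f \<oplus> Dom X g"
    "Cod X (f \<boxplus> g) = Cod X f \<oplus> Cod X g"
    "A = Cod X f \<Longrightarrow> B = Cod X g \<Longrightarrow> \<pi>\<^sub>1 A B \<cdot> (f \<boxplus> g) = f \<cdot> \<pi>\<^sub>1 (Dom X f) (Dom X g)"
    "A = Cod X f \<Longrightarrow> B = Cod X g \<Longrightarrow> \<pi>\<^sub>2 A B \<cdot> (f \<boxplus> g) = g \<cdot> \<pi>\<^sub>2 (Dom X f) (Dom X g)"
  unfolding oplus_map_def using assms by simp_all

lemma prj_oplus_map_assoc [simp]:
  assumes "f \<in> Arr X" "g \<in> Arr X" "x \<in> Arr X" "Cod X x = Dom X f \<oplus> Dom X g"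
    and "A = Cod X f" "B = Cod X g"
  shows "\<pi>\<^sub>1 A B \<cdot> ((f \<boxplus> g) \<cdot> x) = f \<cdot> (\<pi>\<^sub>1 (Dom X f) (Dom X g) \<cdot> x)"
    "\<pi>\<^sub>2 A B \<cdot> ((f \<boxplus> g) \<cdot> x) = g \<cdot> (\<pi>\<^sub>2 (Dom X f) (Dom X g) \<cdot> x)"
  using cmp_reassoc[OF oplus_map(4)] cmp_reassoc[OF oplus_map(5)] assms by simp_all

lemma oplus_map_pairing [simp]:
  assumes "f \<in> Arr X" "g \<in> Arr X" "a \<in> Arr X" "b \<in> Arr X" "Dom X a = Dom X b"
    and "Cod X a = Dom X f" "Cod X b = Dom X g"
  shows "(f \<boxplus> g) \<cdot> pairing X a b = pairing X (f \<cdot> a) (g \<cdot> b)"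
  by (rule product_eqI[of _ _ "Cod X f" "Cod X g"]) (use assms in simp_all)

lemma oplus_map_cmp:
  assumes "f \<in> Arr X" "g \<in> Arr X" "f' \<in> Arr X" "g' \<in> Arr X"
    and "Dom X f' = Cod X f" "Dom X g' = Cod X g"
  shows "(f' \<boxplus> g') \<cdot> (f \<boxplus> g) = (f' \<cdot> f) \<boxplus> (g' \<cdot> g)"
  by (rule product_eqI[of _ _ "Cod X f'" "Cod X g'"]) (use assms in simp_all)

lemma oplus_map_idn: "A \<in> Obj X \<Longrightarrow> B \<in> Obj X \<Longrightarrow> \<one> A \<boxplus> \<one> B = \<one> (A \<oplus> B)"
  by (rule product_eqI[of _ _ A B]) simp_all

text \<open>The map \<open>f \<boxplus> g\<close> is defined through projections, so its behaviour
  on injections has to be derived: after projecting, the diagonal components agree and the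
  off-diagonal ones are zero maps on both sides.\<close>

lemma oplus_map_inj:
  assumes "f \<in> Arr X" "g \<in> Arr X" "A = Dom X f" "B = Dom X g"
  shows "(f \<boxplus> g) \<cdot> \<iota>\<^sub>1 A B = \<iota>\<^sub>1 (Cod X f) (Cod X g) \<cdot> f"
    "(f \<boxplus> g) \<cdot> \<iota>\<^sub>2 A B = \<iota>\<^sub>2 (Cod X f) (Cod X g) \<cdot> g"
  by (rule product_eqI[of _ _ "Cod X f" "Cod X g"]; use assms in simp)+

section \<open>The induced addition of parallel maps\<close>

lemma sum_map_pairing:
  assumes "f \<in> Arr X" "g \<in> Arr X" "Dom X f = Dom X g" "Cod X f = Cod X g"
  shows "f \<^bold>+ g = copairing X (\<one> (Cod X g)) (\<one> (Cod X g)) \<cdot> pairing X f g"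
  unfolding sum_map_def using assms by simp

lemma sum_map_arr [simp]:
  assumes "f \<in> Arr X" "g \<in> Arr X" "Dom X f = Dom X g" "Cod X f = Cod X g"
  shows "f \<^bold>+ g \<in> Arr X" "Dom X (f \<^bold>+ g) = Dom X g" "Cod X (f \<^bold>+ g) = Cod X g"
  using assms by (simp_all add: sum_map_pairing)

lemma sum_map_cmp:
  assumes "f \<in> Arr X" "g \<in> Arr X" "Dom X f = Dom X g" "Cod X f = Cod X g"
    and "x \<in> Arr X" "Cod X x = Dom X g"
  shows "(f \<^bold>+ g) \<cdot> x = f \<cdot> x \<^bold>+ g \<cdot> x"
  using assms by (simp add: sum_map_pairing pairing_cmp)

text \<open>Naturality of the codiagonal: precomposed with either injection, both sides reduce to
  \<open>k\<close>.\<close>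

lemma cmp_codiagonal:
  assumes "k \<in> Arr X"
  shows "k \<cdot> copairing X (\<one> (Dom X k)) (\<one> (Dom X k))
    = copairing X (\<one> (Cod X k)) (\<one> (Cod X k)) \<cdot> (k \<boxplus> k)"
proof (rule coproduct_eqI[of _ _ "Dom X k" "Dom X k"])
  have "copairing X (\<one> (Cod X k)) (\<one> (Cod X k)) \<cdot> (\<iota>\<^sub>1 (Cod X k) (Cod X k) \<cdot> k) = k"
    "copairing X (\<one> (Cod X k)) (\<one> (Cod X k)) \<cdot> (\<iota>\<^sub>2 (Cod X k) (Cod X k) \<cdot> k) = k"
    using assms by (simp_all add: cmp_reassoc[OF copairing(4)] cmp_reassoc[OF copairing(5)])
  then show "(k \<cdot> copairing X (\<one> (Dom X k)) (\<one> (Dom X k))) \<cdot> \<iota>\<^sub>1 (Dom X k) (Dom X k)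
      = (copairing X (\<one> (Cod X k)) (\<one> (Cod X k)) \<cdot> (k \<boxplus> k)) \<cdot> \<iota>\<^sub>1 (Dom X k) (Dom X k)"
    "(k \<cdot> copairing X (\<one> (Dom X k)) (\<one> (Dom X k))) \<cdot> \<iota>\<^sub>2 (Dom X k) (Dom X k)
      = (copairing X (\<one> (Cod X k)) (\<one> (Cod X k)) \<cdot> (k \<boxplus> k)) \<cdot> \<iota>\<^sub>2 (Dom X k) (Dom X k)"
    using assms by (simp_all add: oplus_map_inj)
qed (use assms in simp_all)

text \<open>Naturality of the codiagonal moves \<open>k\<close> inside as
  \<open>k \<boxplus> k\<close>, which the pairing of \<open>f\<close> and \<open>g\<close> then
  absorbs componentwise.\<close>

lemma cmp_sum_map:
  assumes "f \<in> Arr X" "g \<in> Arr X" "Dom X f = Dom X g" "Cod X f = Cod X g"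
    and "k \<in> Arr X" "Dom X k = Cod X g"
  shows "k \<cdot> (f \<^bold>+ g) = k \<cdot> f \<^bold>+ k \<cdot> g"
proof -
  have "k \<cdot> (copairing X (\<one> (Cod X g)) (\<one> (Cod X g)) \<cdot> pairing X f g)
      = (copairing X (\<one> (Cod X k)) (\<one> (Cod X k)) \<cdot> (k \<boxplus> k)) \<cdot> pairing X f g"
    by (rule cmp_reassoc) (use assms cmp_codiagonal[of k] in simp_all)
  then show ?thesis using assms by (simp add: sum_map_pairing)
qed

text \<open>Pairing with a zero second component is the first injection after \<open>f\<close>, and
  the codiagonal is a left inverse of each injection.\<close>

lemma sum_map_zero_right:
  assumes "f \<in> Arr X" "Dom X f = A" "Cod X f = B"
  shows "f \<^bold>+ zero_map X A B = f"
proof -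
  have "A \<in> Obj X" "B \<in> Obj X" using assms by auto
  moreover from this have "pairing X f (zero_map X A B) = \<iota>\<^sub>1 B B \<cdot> f"
    by - (rule product_eqI[of _ _ B B]; use assms in simp)
  ultimately show ?thesis
    using assms by (simp add: sum_map_pairing cmp_reassoc[OF copairing(4)])
qed

lemma sum_map_zero_left:
  assumes "f \<in> Arr X" "Dom X f = A" "Cod X f = B"
  shows "zero_map X A B \<^bold>+ f = f"
proof -
  have "A \<in> Obj X" "B \<in> Obj X" using assms by auto
  moreover from this have "pairing X (zero_map X A B) f = \<iota>\<^sub>2 B B \<cdot> f"
    by - (rule product_eqI[of _ _ B B]; use assms in simp)
  ultimately show ?thesis
    using assms by (simp add: sum_map_pairing cmp_reassoc[OF copairing(5)])
qed

text \<open>Each projection cancels one injection and sends the other summand to zero. Applied to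
  the definition of the fusion operator, this exposes its two components.\<close>

lemma sum_inj_eq_pairing:
  assumes "a \<in> Arr X" "b \<in> Arr X" "Dom X a = Dom X b" "A = Cod X a" "B = Cod X b"
  shows "\<iota>\<^sub>1 A B \<cdot> a \<^bold>+ \<iota>\<^sub>2 A B \<cdot> b = pairing X a b"
  by (rule product_eqI[of _ _ A B])
    (use assms in \<open>simp_all add: cmp_sum_map sum_map_zero_left sum_map_zero_right\<close>)

end

section \<open>The product category\<close>

lemma category_prod_category:
  assumes "category X" "category Y"
  shows "category (prod_category X Y)"
proof -
  interpret X: category X by fact
  interpret Y: category Y by fact
  show ?thesis
    by unfold_locales (auto simp: prod_category_def hom_def)
qed

section \<open>Monads on categories with biproducts\<close>

locale biproduct_monad = biproduct_category X + monad X T \<mu> \<eta>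
  for X :: "('o, 'a, 'm) biproduct_category_scheme" (structure)
    and T :: "('o, 'a, 'o, 'a) functor_data"
    and \<mu> :: "'o \<Rightarrow> 'a"
    and \<eta> :: "'o \<Rightarrow> 'a"
begin

declare T.fob_closed [simp] T.far_id [simp]

section \<open>The monad structure in components\<close>

lemma mult_arr [simp]:
  assumes "A \<in> Obj X"
  shows "\<mu> A \<in> Arr X" "Dom X (\<mu> A) = fob T (fob T A)" "Cod X (\<mu> A) = fob T A"
  using mult.component_hom[OF assms] by (auto simp: hom_def comp_functor_def)

lemma unit_arr [simp]:
  assumes "A \<in> Obj X"
  shows "\<eta> A \<in> Arr X" "Dom X (\<eta> A) = A" "Cod X (\<eta> A) = fob T A"
  using unit.component_hom[OF assms] by (auto simp: hom_def id_functor_def)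

lemma mult_natural:
  assumes "f \<in> Arr X" "B = Cod X f"
  shows "\<mu> B \<cdot> far T (far T f) = far T f \<cdot> \<mu> (Dom X f)"
  using mult.naturality[of f "Dom X f" B] assms by (simp add: hom_def comp_functor_def)

lemma unit_natural:
  assumes "f \<in> Arr X" "A = Dom X f"
  shows "far T f \<cdot> \<eta> A = \<eta> (Cod X f) \<cdot> f"
  using unit.naturality[of f A "Cod X f"] assms by (simp add: hom_def id_functor_def)

lemma unit_natural_assoc:
  assumes "f \<in> Arr X" "A = Dom X f" "x \<in> Arr X" "Cod X x = A"
  shows "far T f \<cdot> (\<eta> A \<cdot> x) = \<eta> (Cod X f) \<cdot> (f \<cdot> x)"
  using cmp_reassoc[OF unit_natural[OF assms(1,2)], of x] assms by simp

section \<open>The fusion operator and its naturality\<close>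

abbreviation fusion :: "'o \<Rightarrow> 'o \<Rightarrow> 'a" where
  "fusion \<equiv> fusion_operator X T \<mu>"

lemma fusion_eq_pairing:
  assumes "A \<in> Obj X" "B \<in> Obj X"
  shows "fusion A B = pairing X (far T (\<pi>\<^sub>1 A (fob T B))) (\<mu> B \<cdot> far T (\<pi>\<^sub>2 A (fob T B)))"
  unfolding fusion_operator_def by (rule sum_inj_eq_pairing) (use assms in simp_all)

lemma fusion_arr [simp]:
  assumes "A \<in> Obj X" "B \<in> Obj X"
  shows "fusion A B \<in> Arr X" "Dom X (fusion A B) = fob T (A \<oplus> fob T B)"
    "Cod X (fusion A B) = fob T A \<oplus> fob T B"
  using assms by (simp_all add: fusion_eq_pairing)

lemma prj_fusion:
  assumes "A \<in> Obj X" "B \<in> Obj X"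
  shows "\<pi>\<^sub>1 (fob T A) (fob T B) \<cdot> fusion A B = far T (\<pi>\<^sub>1 A (fob T B))"
    "\<pi>\<^sub>2 (fob T A) (fob T B) \<cdot> fusion A B = \<mu> B \<cdot> far T (\<pi>\<^sub>2 A (fob T B))"
  using assms by (simp_all add: fusion_eq_pairing)

lemma prj_fusion_assoc:
  assumes "A \<in> Obj X" "B \<in> Obj X" "x \<in> Arr X" "Cod X x = fob T (A \<oplus> fob T B)"
  shows "\<pi>\<^sub>1 (fob T A) (fob T B) \<cdot> (fusion A B \<cdot> x) = far T (\<pi>\<^sub>1 A (fob T B)) \<cdot> x"
    "\<pi>\<^sub>2 (fob T A) (fob T B) \<cdot> (fusion A B \<cdot> x) = \<mu> B \<cdot> (far T (\<pi>\<^sub>2 A (fob T B)) \<cdot> x)"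
  using assms by (simp_all add: fusion_eq_pairing)

text \<open>The first component needs only functoriality of \<open>T\<close>; the second also needs
  naturality of \<open>\<mu>\<close> at \<open>g\<close>.\<close>

lemma fusion_natural:
  assumes "f \<in> Arr X" "g \<in> Arr X" "A' = Cod X f" "B' = Cod X g"
  shows "fusion A' B' \<cdot> far T (f \<boxplus> far T g) = (far T f \<boxplus> far T g) \<cdot> fusion (Dom X f) (Dom X g)"
proof (rule product_eqI[of _ _ "fob T A'" "fob T B'"])
  let ?p = "\<pi>\<^sub>2 (Dom X f) (fob T (Dom X g))"
  have "\<mu> B' \<cdot> (far T (far T g) \<cdot> far T ?p) = far T g \<cdot> (\<mu> (Dom X g) \<cdot> far T ?p)"
    using assms by (subst cmp_reassoc[OF mult_natural]) simp_all
  then show "\<pi>\<^sub>2 (fob T A') (fob T B') \<cdot> (fusion A' B' \<cdot> far T (f \<boxplus> far T g))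
      = \<pi>\<^sub>2 (fob T A') (fob T B') \<cdot> ((far T f \<boxplus> far T g) \<cdot> fusion (Dom X f) (Dom X g))"
    using assms by (simp add: prj_fusion prj_fusion_assoc T.far_cmp)
qed (use assms in \<open>simp_all add: prj_fusion prj_fusion_assoc T.far_cmp\<close>)

lemma cat_functor_fusion_source: "cat_functor (prod_category X X) X (fusion_source X T)"
proof -
  interpret P: category "prod_category X X"
    by (intro category_prod_category category_axioms)
  show ?thesis
    by unfold_locales
      (auto simp: prod_category_def hom_def fusion_source_def oplus_map_idn T.far_cmp oplus_map_cmp)
qed

lemma cat_functor_fusion_target: "cat_functor (prod_category X X) X (fusion_target X T)"
proof -
  interpret P: category "prod_category X X"
    by (intro category_prod_category category_axioms)
  show ?thesis
    by unfold_locales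
      (auto simp: prod_category_def hom_def fusion_target_def oplus_map_idn T.far_cmp oplus_map_cmp)
qed

lemma natural_transformation_fusion:
  "natural_transformation (prod_category X X) X (fusion_source X T) (fusion_target X T)
     (\<lambda>(A, B). fusion A B)"
proof -
  interpret S: cat_functor "prod_category X X" X "fusion_source X T"
    by (rule cat_functor_fusion_source)
  interpret R: cat_functor "prod_category X X" X "fusion_target X T"
    by (rule cat_functor_fusion_target)
  show ?thesis
    by unfold_locales
      (auto simp: prod_category_def hom_def fusion_source_def fusion_target_def fusion_natural)
qed

text \<open>Naturality of the fusion operator holds for every monad here, so the Hopf condition
  reduces to invertibility of each component.\<close>

lemma hopf_monad_iff:
  "hopf_monad X T \<mu> \<eta> \<longleftrightarrow> (\<forall>A \<in> Obj X. \<forall>B \<in> Obj X. isomorphism X (fusion A B))"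
  using natural_transformation_fusion monad_axioms
  by (auto simp: hopf_monad_def natural_isomorphism_def natural_isomorphism_axioms_def prod_category_def)

lemma cat_functor_invertor_target: "cat_functor X X (invertor_target X T)"
  by unfold_locales (auto simp: hom_def invertor_target_def oplus_map_idn T.far_cmp oplus_map_cmp)

section \<open>From Hopf monads to fusion invertors\<close>

abbreviation invertor :: "'o \<Rightarrow> 'a" where
  "invertor \<equiv> (\<lambda>A. inverse_arrow X (fusion A \<zero>) \<cdot> \<iota>\<^sub>1 (fob T A) (fob T \<zero>))"

text \<open>The last equation determines the invertor, since the fusion operator can be cancelled on
  the left. The invertor laws are derived from it rather than from the inverse itself.\<close>

lemma invertor:
  assumes "hopf_monad X T \<mu> \<eta>" "A \<in> Obj X"
  shows "invertor A \<in> Arr X" "Dom X (invertor A) = fob T A" "Cod X (invertor A) = fob T (A \<oplus> fob T \<zero>)"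
    "fusion A \<zero> \<cdot> invertor A = \<iota>\<^sub>1 (fob T A) (fob T \<zero>)"
proof -
  have "inverse_arrows X (fusion A \<zero>) (inverse_arrow X (fusion A \<zero>))"
    using assms by (intro inverse_arrow_inverse) (simp add: hopf_monad_iff)
  then have i: "inverse_arrow X (fusion A \<zero>) \<in> Arr X"
      "Dom X (inverse_arrow X (fusion A \<zero>)) = fob T A \<oplus> fob T \<zero>"
      "Cod X (inverse_arrow X (fusion A \<zero>)) = fob T (A \<oplus> fob T \<zero>)"
      "fusion A \<zero> \<cdot> inverse_arrow X (fusion A \<zero>) = \<one> (fob T A \<oplus> fob T \<zero>)"
    using assms by (auto simp: inverse_arrows_def hom_def)
  then show "invertor A \<in> Arr X" "Dom X (invertor A) = fob T A"
    "Cod X (invertor A) = fob T (A \<oplus> fob T \<zero>)"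
    using assms by simp_all
  show "fusion A \<zero> \<cdot> invertor A = \<iota>\<^sub>1 (fob T A) (fob T \<zero>)"
    using assms i by (simp add: cmp_reassoc[OF i(4)])
qed

text \<open>This identifies the second summand of the inverse formula: it is what the inverse of the
  fusion operator must be on the second injection.\<close>

lemma fusion_inj2_unit:
  assumes "A \<in> Obj X" "B \<in> Obj X"
  shows "fusion A B \<cdot> (far T (\<iota>\<^sub>2 A (fob T B)) \<cdot> \<eta> (fob T B)) = \<iota>\<^sub>2 (fob T A) (fob T B)"
proof (rule product_eqI[of _ _ "fob T A" "fob T B"])
  let ?i = "far T (\<iota>\<^sub>2 A (fob T B)) \<cdot> \<eta> (fob T B)"
  have "\<pi>\<^sub>1 (fob T A) (fob T B) \<cdot> (fusion A B \<cdot> ?i) = far T (zero_map X (fob T B) A) \<cdot> \<eta> (fob T B)"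
    using assms by (simp add: prj_fusion_assoc T.far_cmp_assoc)
  \<comment> \<open>\<open>T\<close> may fail to preserve zero maps. Naturality of
    \<open>\<eta>\<close> strips \<open>T\<close> from the zero map, which then annihilates the
    composite.\<close>
  also have "\<dots> = zero_map X (fob T B) (fob T A)"
    using assms by (simp add: unit_natural)
  finally show "\<pi>\<^sub>1 (fob T A) (fob T B) \<cdot> (fusion A B \<cdot> ?i)
      = \<pi>\<^sub>1 (fob T A) (fob T B) \<cdot> \<iota>\<^sub>2 (fob T A) (fob T B)"
    using assms by simp
  show "\<pi>\<^sub>2 (fob T A) (fob T B) \<cdot> (fusion A B \<cdot> ?i)
      = \<pi>\<^sub>2 (fob T A) (fob T B) \<cdot> \<iota>\<^sub>2 (fob T A) (fob T B)"
    using assms by (simp add: prj_fusion_assoc T.far_cmp_assoc unit_left)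
qed (use assms in simp_all)

lemma fusion_invertor_invertor:
  assumes hopf: "hopf_monad X T \<mu> \<eta>"
  shows "fusion_invertor X T \<mu> \<eta> invertor"
proof -
  note [simp] = invertor(1-3)[OF hopf]
  interpret I: cat_functor X X "invertor_target X T"
    by (rule cat_functor_invertor_target)
  have iso: "isomorphism X (fusion A B)" if "A \<in> Obj X" "B \<in> Obj X" for A B
    using hopf that by (simp add: hopf_monad_iff)
  \<comment> \<open>A shared computation with two uses: \<open>g\<close> the identity of
    \<open>\<zero>\<close> gives naturality of the invertor, and \<open>g\<close> the zero map from
    \<open>\<zero>\<close> to \<open>B\<close> gives the first summand of FI3.\<close>
  have fusion_oplus: "fusion (Cod X f) (Cod X g) \<cdot> (far T (f \<boxplus> far T g) \<cdot> invertor (Dom X f))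
      = \<iota>\<^sub>1 (fob T (Cod X f)) (fob T (Cod X g)) \<cdot> far T f"
    if "f \<in> Arr X" "g \<in> Arr X" "Dom X g = \<zero>" for f g
  proof -
    have "fusion (Cod X f) (Cod X g) \<cdot> (far T (f \<boxplus> far T g) \<cdot> invertor (Dom X f))
        = ((far T f \<boxplus> far T g) \<cdot> fusion (Dom X f) \<zero>) \<cdot> invertor (Dom X f)"
      by (rule cmp_reassoc) (use that in \<open>simp_all add: fusion_natural\<close>)
    also have "\<dots> = (far T f \<boxplus> far T g) \<cdot> (fusion (Dom X f) \<zero> \<cdot> invertor (Dom X f))"
      by (rule cmp_assoc) (use that in simp_all)
    also have "\<dots> = \<iota>\<^sub>1 (fob T (Cod X f)) (fob T (Cod X g)) \<cdot> far T f"
      using that by (simp add: invertor(4)[OF hopf] oplus_map_inj)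
    finally show ?thesis .
  qed
  show ?thesis
  proof unfold_locales
    fix A assume A: "A \<in> Obj X"
    show "invertor A \<in> hom X (fob T A) (fob (invertor_target X T) A)"
      using A by (simp add: invertor_target_def hom_def)
    have "far T (\<pi>\<^sub>1 A (fob T \<zero>)) \<cdot> invertor A = \<pi>\<^sub>1 (fob T A) (fob T \<zero>) \<cdot> (fusion A \<zero> \<cdot> invertor A)"
      using A by (subst prj_fusion_assoc) simp_all
    then show "far T (\<pi>\<^sub>1 A (fob T \<zero>)) \<cdot> invertor A = \<one> (fob T A)"
      using A by (simp add: invertor(4)[OF hopf])
    have "\<mu> \<zero> \<cdot> far T (\<pi>\<^sub>2 A (fob T \<zero>)) \<cdot> invertor A
        = \<pi>\<^sub>2 (fob T A) (fob T \<zero>) \<cdot> (fusion A \<zero> \<cdot> invertor A)"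
      using A by (subst prj_fusion_assoc) simp_all
    then show "\<mu> \<zero> \<cdot> far T (\<pi>\<^sub>2 A (fob T \<zero>)) \<cdot> invertor A = zero_map X (fob T A) (fob T \<zero>)"
      using A by (simp add: invertor(4)[OF hopf])
  next
    fix f A B assume "f \<in> hom X A B"
    then have f: "f \<in> Arr X" "A = Dom X f" "B = Cod X f" by (auto simp: hom_def)
    \<comment> \<open>The identity of \<open>fob T \<zero>\<close> is written as
      \<open>far T (\<one> \<zero>)\<close> to fit the shape of \<open>fusion_oplus\<close>.\<close>
    have "invertor B \<cdot> far T f = far T (f \<boxplus> far T (\<one> \<zero>)) \<cdot> invertor A"
    proof (rule iso_cancel_left[OF iso[of B \<zero>]])
      have "fusion B \<zero> \<cdot> (invertor B \<cdot> far T f) = \<iota>\<^sub>1 (fob T B) (fob T \<zero>) \<cdot> far T f"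
        by (rule cmp_reassoc) (use f in \<open>simp_all add: invertor(4)[OF hopf]\<close>)
      also have "\<dots> = fusion B \<zero> \<cdot> (far T (f \<boxplus> far T (\<one> \<zero>)) \<cdot> invertor A)"
        using fusion_oplus[of f "\<one> \<zero>"] f by simp
      finally show "fusion B \<zero> \<cdot> (invertor B \<cdot> far T f)
          = fusion B \<zero> \<cdot> (far T (f \<boxplus> far T (\<one> \<zero>)) \<cdot> invertor A)" .
    qed (use f in simp_all)
    then show "invertor B \<cdot> far T f = far (invertor_target X T) f \<cdot> invertor A"
      by (simp add: invertor_target_def)
  next
    fix A B assume AB: "A \<in> Obj X" "B \<in> Obj X"
    show "far T (\<one> A \<boxplus> far T (zero_map X \<zero> B)) \<cdot> invertor A \<cdot> far T (\<pi>\<^sub>1 A (fob T B))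
          \<^bold>+ far T (\<iota>\<^sub>2 A (fob T B)) \<cdot> \<eta> (fob T B) \<cdot> \<mu> B \<cdot> far T (\<pi>\<^sub>2 A (fob T B))
          = \<one> (fob T (A \<oplus> fob T B))" (is "?a \<^bold>+ ?b = _")
    proof (rule iso_cancel_left[OF iso[OF AB]])
      let ?z = "far T (\<one> A \<boxplus> far T (zero_map X \<zero> B))"
      let ?p = "far T (\<pi>\<^sub>1 A (fob T B))" and ?q = "\<mu> B \<cdot> far T (\<pi>\<^sub>2 A (fob T B))"
      \<comment> \<open>The bracketing isolates the part that \<open>fusion_oplus\<close> evaluates,
        with \<open>f\<close> the identity of \<open>A\<close> and \<open>g\<close> the zero
        map.\<close>
      have "fusion A B \<cdot> ((?z \<cdot> invertor A) \<cdot> ?p) = \<iota>\<^sub>1 (fob T A) (fob T B) \<cdot> ?p"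
        by (rule cmp_reassoc)
          (use AB fusion_oplus[of "\<one> A" "zero_map X \<zero> B"] in simp_all)
      then have a: "fusion A B \<cdot> ?a = \<iota>\<^sub>1 (fob T A) (fob T B) \<cdot> ?p"
        using AB by simp
      have "fusion A B \<cdot> ((far T (\<iota>\<^sub>2 A (fob T B)) \<cdot> \<eta> (fob T B)) \<cdot> ?q)
          = \<iota>\<^sub>2 (fob T A) (fob T B) \<cdot> ?q"
        by (rule cmp_reassoc[OF fusion_inj2_unit]) (use AB in simp_all)
      then have b: "fusion A B \<cdot> ?b = \<iota>\<^sub>2 (fob T A) (fob T B) \<cdot> ?q"
        using AB by simp
      have "fusion A B \<cdot> (?a \<^bold>+ ?b) = fusion A B \<cdot> ?a \<^bold>+ fusion A B \<cdot> ?b"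
        by (rule cmp_sum_map) (use AB in simp_all)
      \<comment> \<open>The two evaluated summands are literally those in the definition of the
        fusion operator.\<close>
      also have "\<dots> = fusion A B"
        unfolding a b by (rule fusion_operator_def[symmetric])
      finally show "fusion A B \<cdot> (?a \<^bold>+ ?b) = fusion A B \<cdot> \<one> (fob T (A \<oplus> fob T B))"
        using AB by simp
    qed (use AB in simp_all)
  qed
qed

section \<open>From fusion invertors to Hopf monads\<close>

lemma inverse_arrows_fusion:
  assumes "fusion_invertor X T \<mu> \<eta> k" "A \<in> Obj X" "B \<in> Obj X"
  shows "inverse_arrows X (fusion A B)
    (far T (\<one> A \<boxplus> far T (zero_map X \<zero> B)) \<cdot> k A \<cdot> \<pi>\<^sub>1 (fob T A) (fob T B)
      \<^bold>+ far T (\<iota>\<^sub>2 A (fob T B)) \<cdot> \<eta> (fob T B) \<cdot> \<pi>\<^sub>2 (fob T A) (fob T B))"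
    (is "inverse_arrows X _ (?a \<^bold>+ ?b)")
proof -
  interpret k: fusion_invertor X T \<mu> \<eta> k by fact
  have [simp]: "k A \<in> Arr X" "Dom X (k A) = fob T A" "Cod X (k A) = fob T (A \<oplus> fob T \<zero>)"
    using k.component_hom[of A] assms by (auto simp: hom_def invertor_target_def)
  have ab [simp]: "?a \<in> Arr X" "Dom X ?a = fob T A \<oplus> fob T B" "Cod X ?a = fob T (A \<oplus> fob T B)"
    "?b \<in> Arr X" "Dom X ?b = fob T A \<oplus> fob T B" "Cod X ?b = fob T (A \<oplus> fob T B)"
    using assms by simp_all
  have "(?a \<^bold>+ ?b) \<cdot> fusion A B = ?a \<cdot> fusion A B \<^bold>+ ?b \<cdot> fusion A B"
    by (rule sum_map_cmp) (use assms in simp_all)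
  \<comment> \<open>Precomposition with the fusion operator replaces the outer projections by its
    components, which yields the left side of FI3.\<close>
  also have "\<dots> = \<one> (fob T (A \<oplus> fob T B))"
    using assms k.FI3[of A B] by (simp add: prj_fusion)
  finally have left: "(?a \<^bold>+ ?b) \<cdot> fusion A B = \<one> (fob T (A \<oplus> fob T B))" .
  have right: "fusion A B \<cdot> (?a \<^bold>+ ?b) = \<one> (fob T A \<oplus> fob T B)"
  proof (rule product_eqI[of _ _ "fob T A" "fob T B"])
    let ?p = "\<pi>\<^sub>1 (fob T A) (fob T B)" and ?q = "\<pi>\<^sub>2 (fob T A) (fob T B)"
    \<comment> \<open>Under \<open>T\<close>, the first projection passes through the identity
      factor of \<open>\<boxplus>\<close>, so the zero map disappears and FI1 applies.\<close>
    have "far T (\<pi>\<^sub>1 A (fob T B)) \<cdot> ?a = far T (\<pi>\<^sub>1 A (fob T \<zero>)) \<cdot> (k A \<cdot> ?p)"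
      using assms by (simp add: T.far_cmp_assoc)
    also have "\<dots> = ?p"
      using assms by (simp add: cmp_reassoc[OF k.FI1])
    finally have p_a: "far T (\<pi>\<^sub>1 A (fob T B)) \<cdot> ?a = ?p" .
    \<comment> \<open>As in \<open>fusion_inj2_unit\<close>, naturality of \<open>\<eta>\<close>
      brings the zero map out of \<open>T\<close>.\<close>
    have p_b: "far T (\<pi>\<^sub>1 A (fob T B)) \<cdot> ?b = zero_map X (fob T A \<oplus> fob T B) (fob T A)"
      using assms by (simp add: T.far_cmp_assoc unit_natural_assoc)
    show "?p \<cdot> (fusion A B \<cdot> (?a \<^bold>+ ?b)) = ?p \<cdot> \<one> (fob T A \<oplus> fob T B)"
      using assms
      by (simp add: prj_fusion_assoc cmp_sum_map p_a p_b sum_map_zero_right del: cmp_assoc)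
    \<comment> \<open>The second projection leaves \<open>T\<close> applied twice to the zero map.
      Naturality of \<open>\<mu>\<close> carries this past the multiplication, so that the composite
      of FI2 appears next to it.\<close>
    have "\<mu> B \<cdot> (far T (\<pi>\<^sub>2 A (fob T B)) \<cdot> ?a)
        = \<mu> B \<cdot> (far T (far T (zero_map X \<zero> B)) \<cdot> (far T (\<pi>\<^sub>2 A (fob T \<zero>)) \<cdot> (k A \<cdot> ?p)))"
      using assms by (simp add: T.far_cmp_assoc)
    also have "\<dots> = (far T (zero_map X \<zero> B) \<cdot> \<mu> \<zero>) \<cdot> (far T (\<pi>\<^sub>2 A (fob T \<zero>)) \<cdot> (k A \<cdot> ?p))"
      by (rule cmp_reassoc) (use assms in \<open>simp_all add: mult_natural\<close>)
    also have "\<dots> = far T (zero_map X \<zero> B) \<cdot> ((\<mu> \<zero> \<cdot> far T (\<pi>\<^sub>2 A (fob T \<zero>)) \<cdot> k A) \<cdot> ?p)"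
      using assms by simp
    also have "\<dots> = zero_map X (fob T A \<oplus> fob T B) (fob T B)"
      \<comment> \<open>FI2 is rewritten first, because full simplification would reassociate its
        left side away. The resulting zero map makes the product vanish even if
        \<open>far T (zero_map X \<zero> B)\<close> is nonzero.\<close>
      using assms by (simp only: k.FI2) simp
    finally have q_a: "\<mu> B \<cdot> (far T (\<pi>\<^sub>2 A (fob T B)) \<cdot> ?a) = zero_map X (fob T A \<oplus> fob T B) (fob T B)" .
    \<comment> \<open>The second projection cancels the second injection under \<open>T\<close>, and
      the left unit law removes the remaining \<open>\<mu>\<close> and
      \<open>\<eta>\<close>.\<close>
    have q_b: "\<mu> B \<cdot> (far T (\<pi>\<^sub>2 A (fob T B)) \<cdot> ?b) = ?q"
      using assms by (simp add: T.far_cmp_assoc cmp_reassoc[OF unit_left])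
    show "?q \<cdot> (fusion A B \<cdot> (?a \<^bold>+ ?b)) = ?q \<cdot> \<one> (fob T A \<oplus> fob T B)"
      using assms
      by (simp add: prj_fusion_assoc cmp_sum_map q_a q_b sum_map_zero_left del: cmp_assoc)
  qed (use assms in simp_all)
  show ?thesis
    using assms left right by (simp add: inverse_arrows_def hom_def)
qed

end

theorem proposition3p4:
  fixes X :: "('o, 'a, 'm) biproduct_category_scheme"
    and T :: "('o, 'a, 'o, 'a) functor_data"
    and \<mu> \<eta> :: "'o \<Rightarrow> 'a"
  assumes "biproduct_category X" and "monad X T \<mu> \<eta>"
  shows "(hopf_monad X T \<mu> \<eta> \<longleftrightarrow> (\<exists>k. fusion_invertor X T \<mu> \<eta> k))
    \<and> (hopf_monad X T \<mu> \<eta> \<longrightarrow>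
        fusion_invertor X T \<mu> \<eta>
          (\<lambda>A. inverse_arrow X (fusion_operator X T \<mu> A \<zero>\<^bsub>X\<^esub>)
                 \<cdot>\<^bsub>X\<^esub> \<iota>\<^sub>1\<^bsub>X\<^esub> (fob T A) (fob T \<zero>\<^bsub>X\<^esub>)))
    \<and> (\<forall>k. fusion_invertor X T \<mu> \<eta> k \<longrightarrow>
        hopf_monad X T \<mu> \<eta> \<and>
        (\<forall>A \<in> Obj X. \<forall>B \<in> Obj X.
          inverse_arrow X (fusion_operator X T \<mu> A B) =
            far T (\<one>\<^bsub>X\<^esub> A \<boxplus>\<^bsub>X\<^esub> far T (zero_map X \<zero>\<^bsub>X\<^esub> B)) \<cdot>\<^bsub>X\<^esub> k A \<cdot>\<^bsub>X\<^esub> \<pi>\<^sub>1\<^bsub>X\<^esub> (fob T A) (fob T B)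
            \<^bold>+\<^bsub>X\<^esub> far T (\<iota>\<^sub>2\<^bsub>X\<^esub> A (fob T B)) \<cdot>\<^bsub>X\<^esub> \<eta> (fob T B) \<cdot>\<^bsub>X\<^esub> \<pi>\<^sub>2\<^bsub>X\<^esub> (fob T A) (fob T B)))"
proof -
  interpret biproduct_monad X T \<mu> \<eta>
    using assms by (simp add: biproduct_monad_def)
  show ?thesis
    \<comment> \<open>The explicit two-sided inverse gives the Hopf property pointwise, and
      uniqueness of inverses equates it with \<open>inverse_arrow\<close>.\<close>
    using fusion_invertor_invertor inverse_arrows_fusion inverse_arrow_eq
    by (simp add: hopf_monad_iff isomorphism_def) blast
qed

end
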